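(* Let $K$ be a connected graph with $V$ vertices and $E$ edges, and let $t$ be a symmetry (involution) of $K$ having no fixed vertices. Let $I$ be the number of symmetric edges of $K$. Then the number of symmetric $1$-cycles in $K$ equals $$\begin{cases}2^{(E-V+2)/2},&\text{if } I=0,\\ 2^{(E-V+I)/2},&\text{if } I>0.\end{cases}$$
   Context: A graph is a finite simple graph: a finite vertex set together with a family of two-element subsets of it (edges). A $1$-cycle in a graph is a set $C$ of edges (possibly empty) such that every vertex belongs to an even number of edges of $C$. A symmetry (involution) of a graph $K$ is a permutation $t$ of the vertex set such that $t$ takes vertices joined by an edge to vertices joined by an edge, and $t(tv)=v$ for every vertex $v$. A vertex $v$ is fixed if $tv=v$. For an edge $\sigma=\{a,b\}$ put $t\sigma=\{ta,tb\}$, and for a set $Q$ of edges put $tQ=\{t\sigma:\sigma\in Q\}$. A set $Q$ of edges (in particular a $1$-cycle) is symmetric if $tQ=Q$; an edge $\sigma$ is symmetric if $t\sigma=\sigma$. *)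

theory Defs
  imports Complex_Main
begin

definition simple_graph :: "'a set \<Rightarrow> 'a set set \<Rightarrow> bool" where
  "simple_graph V E \<longleftrightarrow> finite V \<and> (\<forall>e\<in>E. e \<subseteq> V \<and> card e = 2)"

definition adj_rel :: "'a set set \<Rightarrow> ('a \<times> 'a) set" where
  "adj_rel E = {(a, b). {a, b} \<in> E}"

text \<open>As usual, the graph without vertices is not regarded as connected.\<close>

definition connected_graph :: "'a set \<Rightarrow> 'a set set \<Rightarrow> bool" where
  "connected_graph V E \<longleftrightarrow>
     simple_graph V E \<and> V \<noteq> {} \<and> (\<forall>u\<in>V. \<forall>v\<in>V. (u, v) \<in> (adj_rel E)\<^sup>*)"

text \<open>Only the values of \<open>t\<close> on \<open>V\<close> matter; nothing is assumed about \<open>t\<close> outside \<open>V\<close>.\<close>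

definition graph_involution :: "'a set \<Rightarrow> 'a set set \<Rightarrow> ('a \<Rightarrow> 'a) \<Rightarrow> bool" where
  "graph_involution V E t \<longleftrightarrow>
     bij_betw t V V \<and>
     (\<forall>a\<in>V. \<forall>b\<in>V. {a, b} \<in> E \<longrightarrow> {t a, t b} \<in> E) \<and>
     (\<forall>v\<in>V. t (t v) = v)"

definition one_cycle :: "'a set \<Rightarrow> 'a set set \<Rightarrow> 'a set set \<Rightarrow> bool" where
  "one_cycle V E C \<longleftrightarrow> C \<subseteq> E \<and> (\<forall>v\<in>V. even (card {e \<in> C. v \<in> e}))"

definition symmetric_edge :: "('a \<Rightarrow> 'a) \<Rightarrow> 'a set \<Rightarrow> bool" where
  "symmetric_edge t e \<longleftrightarrow> t ` e = e"

definition symmetric_edge_set :: "('a \<Rightarrow> 'a) \<Rightarrow> 'a set set \<Rightarrow> bool" where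
  "symmetric_edge_set t Q \<longleftrightarrow> (\<lambda>e. t ` e) ` Q = Q"

end

(* Symmetric edge sets form a vector space over the field with two elements (addition is symmetric
   difference), and the boundary map sends such a set Q to the symmetric set of vertices of odd
   degree in Q; its kernel consists of the symmetric 1-cycles. So the number of symmetric cycles is
   the number of symmetric edge sets divided by the size of the image. By connectedness any two
   vertex orbits {u, tu}, {v, tv} differ by a boundary. If there is a symmetric edge {w, tw}, its
   boundary is a single orbit, so the boundary map is onto the symmetric vertex sets. If there is
   none, a degree count over a transversal of the vertex orbits shows that no single orbit is a
   boundary, so the image has index two. *)

theory Submission
  imports Defs
begin

section \<open>Sets invariant under an involution\<close>

lemma involution_image_eq:
  assumes "\<And>x. x \<in> S \<Longrightarrow> f x \<in> S" "\<And>x. x \<in> S \<Longrightarrow> f (f x) = x"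
  shows "f ` S = S"
proof
  show "S \<subseteq> f ` S"
  proof
    fix x assume x: "x \<in> S"
    show "x \<in> f ` S" by (rule image_eqI[of _ _ "f x"]) (simp_all add: x assms)
  qed
qed (use assms(1) in blast)

text \<open>Invariant sets are thus closed under mod 2 addition; this is applied both to vertex sets
  and to edge sets.\<close>

lemma image_sym_diff_eq:
  assumes "inj_on f X" "A \<subseteq> X" "B \<subseteq> X" "f ` A = A" "f ` B = B"
  shows "f ` sym_diff A B = sym_diff A B"
proof -
  have "f ` (A - B) = f ` A - f ` B" "f ` (B - A) = f ` B - f ` A"
    by (rule inj_on_image_set_diff[OF assms(1)]; use assms(2,3) in blast)+
  then show ?thesis by (simp only: image_Un assms(4,5))
qed

text \<open>Builds \<open>X\<close> orbit by orbit. The added orbit may be a single fixed point, as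
  \<open>f x = x\<close> is allowed.\<close>

lemma involution_set_induct [consumes 1, case_names closed invol empty insert]:
  assumes "finite X"
    and "\<And>x. x \<in> X \<Longrightarrow> f x \<in> X"
    and "\<And>x. x \<in> X \<Longrightarrow> f (f x) = x"
    and "P {}"
    and "\<And>x Y. \<lbrakk>x \<in> X; Y \<subseteq> X; x \<notin> Y; f x \<notin> Y; f ` Y = Y; P Y\<rbrakk> \<Longrightarrow> P (insert x (insert (f x) Y))"
  shows "P X"
proof -
  have "P Y" if "Y \<subseteq> X" "f ` Y \<subseteq> Y" for Y
    using finite_subset[OF \<open>Y \<subseteq> X\<close> \<open>finite X\<close>] that
  proof (induction Y rule: finite_psubset_induct)
    case (psubset Y)
    show ?case
    proof (cases "Y = {}")
      case False
      then obtain x where x: "x \<in> Y" by blast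
      \<comment> \<open>Removing one orbit from an invariant subset leaves a strictly smaller
        invariant subset.\<close>
      define Z where "Z = Y - {x, f x}"
      have ZX: "Z \<subseteq> X" and fx: "f x \<in> Y" and ffx: "f (f x) = x"
        using psubset.prems x assms(3) by (auto simp: Z_def)
      have sub: "f ` Z \<subseteq> Z"
      proof
        fix y assume "y \<in> f ` Z"
        then obtain z where z: "z \<in> Z" "y = f z" by blast
        then have "f y = z" using ZX assms(3) by blast
        moreover have "y \<in> Y" using z psubset.prems(2) by (auto simp: Z_def)
        ultimately show "y \<in> Z" using z ffx by (auto simp: Z_def)
      qed
      have "f ` Z = Z"
        by (rule involution_image_eq) (use sub ZX assms(3) in blast)+
      moreover have "P Z"
        using psubset.IH[of Z] ZX sub x by (auto simp: Z_def)
      ultimately have "P (insert x (insert (f x) Z))"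
        using assms(5)[of x Z] ZX x psubset.prems(1) by (auto simp: Z_def)
      moreover have "insert x (insert (f x) Z) = Y"
        using x fx by (auto simp: Z_def)
      ultimately show ?thesis by simp
    qed (use assms(4) in simp)
  qed
  then show ?thesis using assms(2) by blast
qed

text \<open>An invariant subset is a free choice of orbits, and n points with k fixed ones form
  (n+k)/2 orbits. Squaring avoids the halved exponent.\<close>

lemma card_invariant_subsets:
  assumes "finite X"
    and "\<And>x. x \<in> X \<Longrightarrow> f x \<in> X"
    and "\<And>x. x \<in> X \<Longrightarrow> f (f x) = x"
  shows "(card {S. S \<subseteq> X \<and> f ` S = S})\<^sup>2 = 2 ^ (card X + card {x \<in> X. f x = x})"
  using assms(1)
proof (induction X rule: involution_set_induct[where f = f])
  case empty
  have "{S. S \<subseteq> {} \<and> f ` S = S} = {{}}" by auto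
  then show ?case by simp
next
  case (insert x Y)
  let ?N = "\<lambda>X. {S. S \<subseteq> X \<and> f ` S = S}"
  let ?p = "{x, f x}"
  note Y = insert(1-4)
  have finY: "finite Y" using Y(2) assms(1) by (rule finite_subset)
  have ffx: "f (f x) = x" using Y(1) by (rule assms(3))
  have ffY: "f (f y) = y" if "y \<in> Y" for y using Y(2) assms(3) that by blast
  have fY: "f y \<in> Y" if "y \<in> Y" for y using insert(5) that by blast
  have pair: "?p \<subseteq> S \<or> ?p \<inter> S = {}" if "f ` S = S" for S
  proof -
    have "f y \<in> S" if "y \<in> S" for y using that \<open>f ` S = S\<close> by blast
    from this[of x] this[of "f x"] show ?thesis by (auto simp: ffx)
  qed
  have drop_pair: "f ` (S - ?p) = S - ?p" if S: "S \<subseteq> insert x (insert (f x) Y)" "f ` S = S" for S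
  proof -
    have SY: "S - ?p = S \<inter> Y" using S(1) Y by auto
    have "f ` (S \<inter> Y) = S \<inter> Y"
      by (rule involution_image_eq) (use S(2) fY ffY in blast)+
    then show ?thesis using SY by simp
  qed
  \<comment> \<open>An invariant subset contains the new orbit or misses it, so the count
    doubles.\<close>
  have "?N (insert x (insert (f x) Y)) = ?N Y \<union> (\<lambda>S. ?p \<union> S) ` ?N Y"
  proof (intro equalityI subsetI)
    fix S assume "S \<in> ?N (insert x (insert (f x) Y))"
    then have S: "S \<subseteq> insert x (insert (f x) Y)" "f ` S = S" by simp_all
    show "S \<in> ?N Y \<union> (\<lambda>S. ?p \<union> S) ` ?N Y"
    proof (cases "?p \<subseteq> S")
      case True
      then have "S = ?p \<union> (S - ?p)" by blast
      moreover have "S - ?p \<in> ?N Y" using drop_pair[OF S] S(1) by blast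
      ultimately show ?thesis by blast
    next
      case False
      then have "S \<subseteq> Y" using pair[OF S(2)] S(1) by blast
      then show ?thesis using S(2) by simp
    qed
  next
    fix S assume "S \<in> ?N Y \<union> (\<lambda>S. ?p \<union> S) ` ?N Y"
    moreover have "f ` (?p \<union> T) = ?p \<union> T" if "f ` T = T" for T
      unfolding image_Un that by (simp add: ffx insert_commute)
    ultimately show "S \<in> ?N (insert x (insert (f x) Y))" by blast
  qed
  moreover have "?N Y \<inter> (\<lambda>S. ?p \<union> S) ` ?N Y = {}" using Y by blast
  moreover have "inj_on (\<lambda>S. ?p \<union> S) (?N Y)"
    by (rule inj_on_inverseI[where g = "\<lambda>S. S - ?p"]) (use Y in blast)
  moreover have "finite (?N Y)" using finY by simp
  ultimately have N: "card (?N (insert x (insert (f x) Y))) = 2 * card (?N Y)"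
    by (simp add: card_Un_disjoint card_image)
  have IH: "(card (?N Y))\<^sup>2 = 2 ^ (card Y + card {x \<in> Y. f x = x})"
    using insert(6) .
  \<comment> \<open>A new fixed point adds 1 to each summand, a new two-point orbit adds 2 to the
    first only. The rise by 2 matches the squared doubling.\<close>
  have "card (insert x (insert (f x) Y)) + card {y \<in> insert x (insert (f x) Y). f y = y}
      = card Y + card {y \<in> Y. f y = y} + 2"
  proof (cases "f x = x")
    case True
    then have "{y \<in> insert x (insert (f x) Y). f y = y} = insert x {y \<in> Y. f y = y}" by auto
    then show ?thesis using True Y finY by simp
  next
    case False
    then have "{y \<in> insert x (insert (f x) Y). f y = y} = {y \<in> Y. f y = y}" using ffx by auto
    then show ?thesis using False Y finY by simp
  qed
  then show ?case by (simp only: N IH power_mult_distrib power_add) simp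
qed (simp_all add: assms(2,3))

lemma even_card_fixpoint_free:
  assumes "finite X"
    and "\<And>x. x \<in> X \<Longrightarrow> f x \<in> X"
    and "\<And>x. x \<in> X \<Longrightarrow> f (f x) = x"
    and "\<And>x. x \<in> X \<Longrightarrow> f x \<noteq> x"
  shows "even (card X)"
  using assms(1)
proof (induction X rule: involution_set_induct[where f = f])
  case (insert x Y)
  have "finite Y" using insert(2) assms(1) by (rule finite_subset)
  then show ?case using insert(3,4,6) assms(4)[OF insert(1)] by simp
qed (simp_all add: assms(2,3))

lemma even_card_sym_diff:
  assumes "finite A" "finite B"
  shows "even (card (sym_diff A B)) \<longleftrightarrow> even (card A + card B)"
proof -
  have "card (sym_diff A B) = card (A - B) + card (B - A)"
    by (rule card_Un_disjoint) (use assms in auto)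
  moreover have "card A = card (A - B) + card (A \<inter> B)"
    using assms card_Diff_subset_Int card_Int_Diff by (metis add.commute)
  moreover have "card B = card (B - A) + card (A \<inter> B)"
    using assms card_Int_Diff by (metis add.commute Int_commute)
  ultimately show ?thesis by presburger
qed

section \<open>The boundary map\<close>

definition boundary :: "'a set \<Rightarrow> 'a set set \<Rightarrow> 'a set" where
  "boundary V Q = {v \<in> V. odd (card {e \<in> Q. v \<in> e})}"

lemma one_cycle_iff_boundary: "one_cycle V E C \<longleftrightarrow> C \<subseteq> E \<and> boundary V C = {}"
  by (auto simp: one_cycle_def boundary_def)

lemma boundary_empty [simp]: "boundary V {} = {}"
  by (simp add: boundary_def)

lemma boundary_single: "e \<subseteq> V \<Longrightarrow> boundary V {e} = e"
proof -
  assume "e \<subseteq> V"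
  moreover have "{e' \<in> {e}. v \<in> e'} = (if v \<in> e then {e} else {})" for v by auto
  ultimately show ?thesis by (auto simp: boundary_def split: if_splits)
qed

text \<open>Degrees add modulo 2, since an edge common to \<open>P\<close> and \<open>Q\<close>
  counts twice: the boundary map is linear.\<close>

lemma boundary_sym_diff:
  assumes "finite P" "finite Q"
  shows "boundary V (sym_diff P Q) = sym_diff (boundary V P) (boundary V Q)"
proof -
  have "{e \<in> sym_diff P Q. v \<in> e} = sym_diff {e \<in> P. v \<in> e} {e \<in> Q. v \<in> e}" for v by auto
  moreover have "even (card (sym_diff {e \<in> P. v \<in> e} {e \<in> Q. v \<in> e}))
      \<longleftrightarrow> even (card {e \<in> P. v \<in> e} + card {e \<in> Q. v \<in> e})" for v
    by (rule even_card_sym_diff) (use assms in auto)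
  ultimately show ?thesis by (auto simp: boundary_def)
qed

section \<open>Graphs with a free involution\<close>

locale free_involution_graph =
  fixes V :: "'a set" and E :: "'a set set" and t :: "'a \<Rightarrow> 'a"
  assumes connected: "connected_graph V E"
    and involution: "graph_involution V E t"
    and free: "v \<in> V \<Longrightarrow> t v \<noteq> v"
begin

definition sym_edge_sets :: "'a set set set" where
  "sym_edge_sets = {Q. Q \<subseteq> E \<and> (`) t ` Q = Q}"

definition sym_vertex_sets :: "'a set set" where
  "sym_vertex_sets = {S. S \<subseteq> V \<and> t ` S = S}"

definition sym_cycles :: "'a set set set" where
  "sym_cycles = {Q \<in> sym_edge_sets. boundary V Q = {}}"

definition boundaries :: "'a set set" where
  "boundaries = boundary V ` sym_edge_sets"

lemma finite_V: "finite V"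
  using connected by (simp add: connected_graph_def simple_graph_def)

lemma edge_subset: "e \<in> E \<Longrightarrow> e \<subseteq> V"
  using connected by (simp add: connected_graph_def simple_graph_def)

lemma edge_card: "e \<in> E \<Longrightarrow> card e = 2"
  using connected by (simp add: connected_graph_def simple_graph_def)

lemma finite_E: "finite E"
  using finite_V edge_subset by (meson finite_Pow_iff finite_subset PowI subsetI)

lemma t_in_V: "v \<in> V \<Longrightarrow> t v \<in> V"
  using involution by (auto simp: graph_involution_def bij_betw_def)

lemma t_t: "v \<in> V \<Longrightarrow> t (t v) = v"
  using involution by (simp add: graph_involution_def)

lemma t_edge: "e \<in> E \<Longrightarrow> t ` e \<in> E"
proof -
  assume e: "e \<in> E"
  then obtain a b where ab: "e = {a, b}" using edge_card by (meson card_2_iff)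
  then have "a \<in> V" "b \<in> V" using e edge_subset by blast+
  then show ?thesis using e ab involution by (auto simp: graph_involution_def)
qed

lemma t_t_edge: "e \<in> E \<Longrightarrow> t ` t ` e = e"
  using edge_subset t_t by (force simp: image_image)

lemma finite_sym_edge_set: "Q \<in> sym_edge_sets \<Longrightarrow> finite Q"
  using finite_E finite_subset by (auto simp: sym_edge_sets_def)

lemma finite_sym_edge_sets: "finite sym_edge_sets"
  using finite_E by (simp add: sym_edge_sets_def)

section \<open>The boundary as a linear map on symmetric edge sets\<close>

lemma sym_edge_sets_sym_diff:
  assumes "P \<in> sym_edge_sets" "Q \<in> sym_edge_sets"
  shows "sym_diff P Q \<in> sym_edge_sets"
proof -
  have "inj_on ((`) t) E" by (rule inj_onI) (metis t_t_edge)
  then have "(`) t ` sym_diff P Q = sym_diff P Q"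
    by (rule image_sym_diff_eq) (use assms in \<open>simp_all add: sym_edge_sets_def\<close>)
  then show ?thesis using assms by (auto simp: sym_edge_sets_def)
qed

text \<open>The edge action of \<open>t\<close> matches the edges of \<open>Q\<close> at
  \<open>t v\<close> with those at \<open>v\<close>, so degrees in \<open>Q\<close> are constant on
  vertex orbits.\<close>

lemma boundary_in_sym_vertex_sets:
  assumes "Q \<in> sym_edge_sets"
  shows "boundary V Q \<in> sym_vertex_sets"
proof -
  have Q: "Q \<subseteq> E" "\<And>e. e \<in> Q \<Longrightarrow> t ` e \<in> Q" using assms by (auto simp: sym_edge_sets_def)
  have deg: "card {e \<in> Q. t v \<in> e} = card {e \<in> Q. v \<in> e}" if v: "v \<in> V" for v
  proof (rule bij_betw_same_card[of "(`) t"], rule bij_betw_byWitness[where f' = "(`) t"])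
    show "(`) t ` {e \<in> Q. t v \<in> e} \<subseteq> {e \<in> Q. v \<in> e}"
    proof clarsimp
      fix e assume e: "e \<in> Q" "t v \<in> e"
      have "t (t v) \<in> t ` e" using e(2) by (rule imageI)
      then show "t ` e \<in> Q \<and> v \<in> t ` e" using Q(2)[OF e(1)] t_t[OF v] by simp
    qed
    show "(`) t ` {e \<in> Q. v \<in> e} \<subseteq> {e \<in> Q. t v \<in> e}"
      using Q(2) by auto
  qed (use Q(1) t_t_edge in blast)+
  have "t v \<in> boundary V Q" if "v \<in> boundary V Q" for v
    using that deg t_in_V by (auto simp: boundary_def)
  then have "t ` boundary V Q = boundary V Q"
    by (rule involution_image_eq) (assumption, simp add: boundary_def t_t)
  then show ?thesis by (auto simp: sym_vertex_sets_def boundary_def)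
qed

lemma boundaries_sym_diff:
  assumes "S \<in> boundaries" "T \<in> boundaries"
  shows "sym_diff S T \<in> boundaries"
proof -
  obtain P Q where "P \<in> sym_edge_sets" "Q \<in> sym_edge_sets" "S = boundary V P" "T = boundary V Q"
    using assms by (auto simp: boundaries_def)
  then have "sym_diff S T = boundary V (sym_diff P Q)" "sym_diff P Q \<in> sym_edge_sets"
    by (simp_all add: boundary_sym_diff finite_sym_edge_set sym_edge_sets_sym_diff)
  then show ?thesis unfolding boundaries_def by blast
qed

text \<open>Each fibre of a linear map is a coset of the kernel: adding a fixed member
  \<open>P\<close> of the fibre is a self-inverse translation onto
  \<open>sym_cycles\<close>.\<close>

lemma card_sym_edge_sets_eq: "card sym_edge_sets = card sym_cycles * card boundaries"
proof -
  have fibre: "card {Q \<in> sym_edge_sets. boundary V Q = S} = card sym_cycles" if S: "S \<in> boundaries" for S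
  proof -
    obtain P where P: "P \<in> sym_edge_sets" "S = boundary V P"
      using S unfolding boundaries_def by blast
    have inv: "sym_diff P (sym_diff P Q) = Q" for Q by blast
    have "bij_betw (\<lambda>Q. sym_diff P Q) {Q \<in> sym_edge_sets. boundary V Q = S} sym_cycles"
    proof (rule bij_betw_byWitness[where f' = "\<lambda>Q. sym_diff P Q"])
      show "(\<lambda>Q. sym_diff P Q) ` {Q \<in> sym_edge_sets. boundary V Q = S} \<subseteq> sym_cycles"
        using P by (auto simp: sym_cycles_def sym_edge_sets_sym_diff boundary_sym_diff finite_sym_edge_set)
      show "(\<lambda>Q. sym_diff P Q) ` sym_cycles \<subseteq> {Q \<in> sym_edge_sets. boundary V Q = S}"
        using P by (auto simp: sym_cycles_def sym_edge_sets_sym_diff boundary_sym_diff finite_sym_edge_set)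
    qed (simp_all only: inv ball_simps, simp_all)
    then show ?thesis by (rule bij_betw_same_card)
  qed
  have "card sym_edge_sets = (\<Sum>S\<in>boundaries. card {Q \<in> sym_edge_sets. boundary V Q = S})"
    unfolding boundaries_def
    using sum.image_gen[OF finite_sym_edge_sets, of "\<lambda>_. 1" "boundary V"]
    by (simp only: card_eq_sum)
  then show ?thesis by (simp add: fibre)
qed

section \<open>Vertex orbits modulo boundaries\<close>

text \<open>The difference is the boundary of the edge together with its image. If
  \<open>v = t u\<close>, the two orbits coincide and the empty edge set serves.\<close>

lemma adjacent_orbits:
  assumes "{u, v} \<in> E"
  shows "sym_diff {u, t u} {v, t v} \<in> boundaries"
proof (cases "v = t u")
  case True
  moreover have "t (t u) = u" using assms edge_subset t_t by blast
  ultimately have "sym_diff {u, t u} {v, t v} = boundary V {}" by auto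
  then show ?thesis unfolding boundaries_def
    by (intro image_eqI[where x = "{}"]) (auto simp: sym_edge_sets_def)
next
  case False
  let ?e = "{u, v}"
  have V: "u \<in> V" "v \<in> V" using assms edge_subset by auto
  have "u \<noteq> v" using edge_card[OF assms] by auto
  \<comment> \<open>A symmetric edge would have \<open>t u = u\<close> or \<open>t u = v\<close>,
    both excluded here.\<close>
  have te: "t ` ?e \<noteq> ?e" using False free[OF V(1)] by (auto simp: doubleton_eq_iff)
  then have "sym_diff {?e} {t ` ?e} = {?e, t ` ?e}" by auto
  then have "boundary V {?e, t ` ?e} = sym_diff ?e (t ` ?e)"
    using boundary_sym_diff[of "{?e}" "{t ` ?e}" V] boundary_single[OF edge_subset[OF assms]]
      boundary_single[OF edge_subset[OF t_edge[OF assms]]]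
    by simp
  \<comment> \<open>The vertices \<open>u\<close>, \<open>v\<close>, \<open>t u\<close>,
    \<open>t v\<close> are distinct, so each side consists of all four.\<close>
  also have "\<dots> = sym_diff {u, t u} {v, t v}"
    using False \<open>u \<noteq> v\<close> free[OF V(1)] free[OF V(2)] t_t[OF V(1)] t_t[OF V(2)] by auto
  finally have "sym_diff {u, t u} {v, t v} = boundary V {?e, t ` ?e}" ..
  moreover have "{?e, t ` ?e} \<in> sym_edge_sets"
    using t_t_edge[OF assms] t_edge[OF assms] assms by (auto simp: sym_edge_sets_def)
  ultimately show ?thesis by (auto simp: boundaries_def)
qed

text \<open>Along a path from \<open>u\<close> to \<open>v\<close> the differences of consecutive
  orbits telescope.\<close>

lemma orbits_differ_by_boundary:
  assumes "u \<in> V" "v \<in> V"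
  shows "sym_diff {u, t u} {v, t v} \<in> boundaries"
proof -
  have "(u, v) \<in> (adj_rel E)\<^sup>*" using connected assms by (simp add: connected_graph_def)
  then show ?thesis
  proof (induction rule: rtrancl_induct)
    case base
    have "boundary V {} \<in> boundaries" unfolding boundaries_def
      by (intro imageI) (simp add: sym_edge_sets_def)
    then show ?case by simp
  next
    case (step y z)
    have "sym_diff {y, t y} {z, t z} \<in> boundaries"
      using step by (intro adjacent_orbits) (simp add: adj_rel_def)
    with step.IH have "sym_diff (sym_diff {u, t u} {y, t y}) (sym_diff {y, t y} {z, t z}) \<in> boundaries"
      by (rule boundaries_sym_diff)
    moreover have "sym_diff (sym_diff A B) (sym_diff B C) = sym_diff A C" for A B C :: "'a set" by blast
    ultimately show ?case by simp
  qed
qed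

text \<open>Modulo boundaries every orbit equals that of \<open>w\<close>, so a union of orbits is
  congruent to the empty set or to that orbit, by the parity of their number.\<close>

lemma sym_vertex_set_boundary_cases:
  assumes "w \<in> V" "S \<in> sym_vertex_sets"
  shows "S \<in> boundaries \<or> sym_diff S {w, t w} \<in> boundaries"
proof -
  have S: "S \<subseteq> V" "t ` S = S" using assms by (auto simp: sym_vertex_sets_def)
  have "finite S" using S finite_V finite_subset by blast
  then show ?thesis
  proof (induction S rule: involution_set_induct[where f = t])
    case empty
    have "boundary V {} \<in> boundaries" unfolding boundaries_def
      by (intro imageI) (simp add: sym_edge_sets_def)
    then show ?case by simp
  next
    case (insert x Y)
    have D: "sym_diff {x, t x} {w, t w} \<in> boundaries"
      using insert S assms by (intro orbits_differ_by_boundary) auto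
    have xY: "insert x (insert (t x) Y) = sym_diff Y {x, t x}" using insert by auto
    \<comment> \<open>Adding the orbit of \<open>x\<close>, congruent to that of \<open>w\<close>,
      exchanges the two alternatives.\<close>
    from insert consider "Y \<in> boundaries" | "sym_diff Y {w, t w} \<in> boundaries" by blast
    then show ?case
    proof cases
      case 1
      then have "sym_diff Y (sym_diff {x, t x} {w, t w}) \<in> boundaries"
        using D by (rule boundaries_sym_diff)
      moreover have "sym_diff A (sym_diff B C) = sym_diff (sym_diff A B) C" for A B C :: "'a set"
        by blast
      ultimately show ?thesis using xY by simp
    next
      case 2
      then have "sym_diff (sym_diff Y {w, t w}) (sym_diff {x, t x} {w, t w}) \<in> boundaries"
        using D by (rule boundaries_sym_diff)
      moreover have "sym_diff (sym_diff A C) (sym_diff B C) = sym_diff A B" for A B C :: "'a set"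
        by blast
      ultimately show ?thesis using xY by simp
    qed
  qed (use S t_t in auto)
qed

lemma boundaries_subset: "boundaries \<subseteq> sym_vertex_sets"
  using boundary_in_sym_vertex_sets by (auto simp: boundaries_def)

text \<open>As \<open>t\<close> moves every vertex, the symmetric edge is an orbit
  \<open>{w, t w}\<close>, and it is the boundary of \<open>{e}\<close>. Adding this boundary
  removes the second alternative of \<open>sym_vertex_set_boundary_cases\<close>.\<close>

lemma boundaries_eq_sym_vertex_sets:
  assumes "e \<in> E" "t ` e = e"
  shows "boundaries = sym_vertex_sets"
proof -
  obtain w u where wu: "e = {w, u}" "w \<noteq> u" using edge_card[OF assms(1)] by (meson card_2_iff)
  have w: "w \<in> V" using wu edge_subset[OF assms(1)] by auto
  have "t w \<in> e" using assms(2) wu by blast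
  then have e: "e = {w, t w}" using wu free[OF w] by auto
  have "boundary V {e} = e" using edge_subset[OF assms(1)] by (rule boundary_single)
  moreover have "{e} \<in> sym_edge_sets" using assms by (auto simp: sym_edge_sets_def)
  ultimately have eb: "{w, t w} \<in> boundaries" unfolding boundaries_def e[symmetric] by force
  have "S \<in> boundaries" if "S \<in> sym_vertex_sets" for S
    using sym_vertex_set_boundary_cases[OF w that]
  proof
    assume "sym_diff S {w, t w} \<in> boundaries"
    then have "sym_diff (sym_diff S {w, t w}) {w, t w} \<in> boundaries"
      using eb by (rule boundaries_sym_diff)
    moreover have "sym_diff (sym_diff A B) B = A" for A B :: "'a set" by blast
    ultimately show ?thesis by simp
  qed
  then show ?thesis using boundaries_subset by blast
qed

section \<open>The parity obstruction without symmetric edges\<close>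

lemma transversal_exists: "\<exists>R\<subseteq>V. \<forall>v\<in>V. (v \<in> R) \<noteq> (t v \<in> R)"
proof -
  \<comment> \<open>The choice depends only on the set \<open>{v, t v}\<close>, which is the same
    for \<open>v\<close> and \<open>t v\<close>; hence exactly one of them is selected.\<close>
  define R where "R = {v \<in> V. (SOME x. x \<in> {v, t v}) = v}"
  have "(v \<in> R) \<noteq> (t v \<in> R)" if v: "v \<in> V" for v
  proof -
    have "{t v, t (t v)} = {v, t v}" using t_t[OF v] by auto
    then have "v \<in> R \<longleftrightarrow> (SOME x. x \<in> {v, t v}) = v" "t v \<in> R \<longleftrightarrow> (SOME x. x \<in> {v, t v}) = t v"
      using v t_in_V[OF v] by (simp_all add: R_def del: insert_iff)
    moreover have "(SOME x. x \<in> {v, t v}) \<in> {v, t v}" by (rule someI[of _ v]) simp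
    ultimately show ?thesis using free[OF v] by auto
  qed
  moreover have "R \<subseteq> V" unfolding R_def by blast
  ultimately show ?thesis by blast
qed

text \<open>The degrees in \<open>Q\<close> are summed over a transversal \<open>R\<close>. The sum
  equals \<open>card Q\<close>, which is even because \<open>t\<close> fixes no edge; but if the
  boundary were one orbit, exactly one vertex of \<open>R\<close> would have odd degree.\<close>

lemma orbit_not_boundary:
  assumes "\<And>e. e \<in> E \<Longrightarrow> t ` e \<noteq> e" "w \<in> V"
  shows "{w, t w} \<notin> boundaries"
proof
  assume "{w, t w} \<in> boundaries"
  then obtain Q where Q: "Q \<in> sym_edge_sets" "{w, t w} = boundary V Q"
    by (auto simp: boundaries_def)
  have QE: "Q \<subseteq> E" "(`) t ` Q = Q" and finQ: "finite Q"
    using Q finite_sym_edge_set by (auto simp: sym_edge_sets_def)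
  obtain R where R: "R \<subseteq> V" "\<And>v. v \<in> V \<Longrightarrow> (v \<in> R) \<noteq> (t v \<in> R)"
    using transversal_exists by blast
  have finR: "finite R" using R finite_V finite_subset by blast
  \<comment> \<open>For each end \<open>a\<close> of \<open>e\<close>, exactly one of
    \<open>a\<close> and \<open>t a\<close> lies in \<open>R\<close>.\<close>
  have two: "card (e \<inter> R) + card (t ` e \<inter> R) = 2" if "e \<in> Q" for e
  proof -
    have "e \<in> E" using that QE(1) by blast
    then have e: "e \<subseteq> V" "card e = 2" by (rule edge_subset, rule edge_card)
    then have "finite e" by (intro card_ge_0_finite) simp
    have "t ` e \<inter> R = t ` (e - R)" using e(1) R(2) by blast
    moreover have "inj_on t (e - R)"
      by (rule inj_on_inverseI[where g = t]) (use e(1) t_t in blast)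
    ultimately have "card (t ` e \<inter> R) = card (e - R)" by (simp add: card_image)
    then show ?thesis using e(2) card_Int_Diff[OF \<open>finite e\<close>, of R] by simp
  qed
  have inj: "inj_on ((`) t) Q" by (rule inj_onI) (metis QE(1) subsetD t_t_edge)
  \<comment> \<open>Since \<open>t\<close> permutes \<open>Q\<close>, both terms of
    \<open>two\<close> have the same sum over \<open>Q\<close>, so each sum is
    \<open>card Q\<close>.\<close>
  have "(\<Sum>e\<in>Q. card (t ` e \<inter> R)) = (\<Sum>e\<in>Q. card (e \<inter> R))"
    using sum.reindex[OF inj, of "\<lambda>e. card (e \<inter> R)"] QE by simp
  moreover have "(\<Sum>e\<in>Q. card (e \<inter> R) + card (t ` e \<inter> R)) = 2 * card Q"
    by (simp add: two)
  ultimately have sum_eq: "(\<Sum>e\<in>Q. card (e \<inter> R)) = card Q"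
    by (simp add: sum.distrib)
  have "even (card Q)"
  proof (rule even_card_fixpoint_free[OF finQ])
    fix e assume "e \<in> Q"
    then have "e \<in> E" "t ` e \<in> (`) t ` Q" using QE(1) by blast+
    then show "t ` e \<in> Q" "t ` t ` e = e" "t ` e \<noteq> e"
      by (simp_all only: QE(2) t_t_edge assms(1) not_False_eq_True)
  qed
  \<comment> \<open>Double count of incidences between \<open>R\<close> and
    \<open>Q\<close>.\<close>
  moreover have "(\<Sum>v\<in>R. card {e \<in> Q. v \<in> e}) = (\<Sum>e\<in>Q. card (e \<inter> R))"
  proof -
    have "(\<Sum>v\<in>R. card {e \<in> Q. v \<in> e}) = (\<Sum>v\<in>R. \<Sum>e\<in>Q. if v \<in> e then 1 else 0)"
      using finQ by (simp add: sum.If_cases Int_def)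
    also have "\<dots> = (\<Sum>e\<in>Q. \<Sum>v\<in>R. if v \<in> e then 1 else 0)" by (rule sum.swap)
    also have "\<dots> = (\<Sum>e\<in>Q. card (e \<inter> R))"
      using finR by (simp add: sum.If_cases Int_def conj_commute)
    finally show ?thesis .
  qed
  ultimately have "even (\<Sum>v\<in>R. card {e \<in> Q. v \<in> e})" using sum_eq by simp
  \<comment> \<open>A sum has the parity of the number of its odd terms.\<close>
  then have "even (card {v \<in> R. odd (card {e \<in> Q. v \<in> e})})"
    using finR by (simp add: even_sum_iff)
  moreover have "{v \<in> R. odd (card {e \<in> Q. v \<in> e})} = {w, t w} \<inter> R"
    using R(1) unfolding Q(2) boundary_def by auto
  moreover have "card ({w, t w} \<inter> R) = 1"
    using R(2)[OF assms(2)] by (cases "w \<in> R") (auto simp: Int_insert_left)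
  ultimately show False by simp
qed

text \<open>The symmetric vertex sets split into two cosets of \<open>boundaries\<close>, one
  translated by a single orbit.\<close>

lemma card_sym_vertex_sets_no_sym_edge:
  assumes "\<And>e. e \<in> E \<Longrightarrow> t ` e \<noteq> e"
  shows "card sym_vertex_sets = 2 * card boundaries"
proof -
  obtain w where w: "w \<in> V" using connected by (auto simp: connected_graph_def)
  let ?p = "{w, t w}"
  have inv: "sym_diff (sym_diff A B) B = A" for A B :: "'a set" by blast
  have p: "sym_diff S ?p \<in> sym_vertex_sets" if "S \<in> sym_vertex_sets" for S
  proof -
    have S: "S \<subseteq> V" "t ` S = S" using that by (auto simp: sym_vertex_sets_def)
    have inj: "inj_on t V" using involution by (simp add: graph_involution_def bij_betw_def)
    have p: "?p \<subseteq> V" "t ` ?p = ?p" using w t_in_V t_t by auto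
    have "t ` sym_diff S ?p = sym_diff S ?p"
      by (rule image_sym_diff_eq[OF inj S(1) p(1) S(2) p(2)])
    moreover have "sym_diff S ?p \<subseteq> V" using S(1) p(1) by blast
    ultimately show ?thesis unfolding sym_vertex_sets_def by blast
  qed
  have "sym_vertex_sets = boundaries \<union> (\<lambda>S. sym_diff S ?p) ` boundaries"
  proof (intro equalityI subsetI)
    fix S assume "S \<in> sym_vertex_sets"
    from sym_vertex_set_boundary_cases[OF w this]
    show "S \<in> boundaries \<union> (\<lambda>S. sym_diff S ?p) ` boundaries"
    proof
      assume "sym_diff S ?p \<in> boundaries"
      then show ?thesis by (intro UnI2 image_eqI[of _ _ "sym_diff S ?p"]) (simp only: inv)
    qed (rule UnI1)
  qed (use boundaries_subset p in blast)
  moreover have "boundaries \<inter> (\<lambda>S. sym_diff S ?p) ` boundaries = {}"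
  proof -
    \<comment> \<open>Otherwise the orbit \<open>?p\<close>, as a sum of two boundaries, would be a
      boundary.\<close>
    have "sym_diff S ?p \<notin> boundaries" if "S \<in> boundaries" for S
    proof
      assume "sym_diff S ?p \<in> boundaries"
      then have "sym_diff S (sym_diff S ?p) \<in> boundaries" by (rule boundaries_sym_diff[OF that])
      moreover have "sym_diff S (sym_diff S ?p) = ?p" by blast
      ultimately show False using orbit_not_boundary[OF assms w] by simp
    qed
    then show ?thesis by blast
  qed
  moreover have "inj_on (\<lambda>S. sym_diff S ?p) boundaries"
    by (rule inj_on_inverseI[where g = "\<lambda>S. sym_diff S ?p"]) (rule inv)
  moreover have "finite boundaries" using finite_sym_edge_sets by (simp add: boundaries_def)
  ultimately show ?thesis by (simp add: card_Un_disjoint card_image)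
qed

section \<open>The final count\<close>

text \<open>Combines the orbit counts for edges and vertices with the index of
  \<open>boundaries\<close>. Squares and a product keep the statement in the naturals, without
  halves or differences in exponents.\<close>

lemma card_sym_cycles:
  "(card sym_cycles)\<^sup>2 * 2 ^ card V =
    2 ^ (card E + (if {e \<in> E. t ` e = e} = {} then 2 else card {e \<in> E. t ` e = e}))"
proof -
  have cE: "(card sym_edge_sets)\<^sup>2 = 2 ^ (card E + card {e \<in> E. t ` e = e})"
    unfolding sym_edge_sets_def
    by (rule card_invariant_subsets) (use finite_E t_edge t_t_edge in auto)
  have no_fix: "{v \<in> V. t v = v} = {}" using free by auto
  have cV: "(card sym_vertex_sets)\<^sup>2 = 2 ^ card V"
    using card_invariant_subsets[OF finite_V t_in_V t_t] by (simp only: sym_vertex_sets_def no_fix) simp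
  show ?thesis
  proof (cases "{e \<in> E. t ` e = e} = {}")
    case True
    then have "card sym_vertex_sets = 2 * card boundaries"
      by (intro card_sym_vertex_sets_no_sym_edge) auto
    \<comment> \<open>Index two, squared, gives the factor 4; this is the exponent 2 that stands in
      for the number of symmetric edges.\<close>
    then have "(card sym_cycles)\<^sup>2 * 2 ^ card V = 4 * (card sym_edge_sets)\<^sup>2"
      unfolding cV[symmetric] card_sym_edge_sets_eq by (simp add: power_mult_distrib)
    then show ?thesis using True unfolding cE by (simp add: power_add)
  next
    case False
    then have "sym_vertex_sets = boundaries" using boundaries_eq_sym_vertex_sets by blast
    then show ?thesis
      using False unfolding cV[symmetric] if_not_P[OF False] cE[symmetric] card_sym_edge_sets_eq
      by (simp add: power_mult_distrib)
  qed
qed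

end

theorem mainTheorem1:
  fixes V :: "'a set" and E :: "'a set set" and t :: "'a \<Rightarrow> 'a" and I :: nat
  assumes "connected_graph V E"
    and "graph_involution V E t"
    and "\<forall>v\<in>V. t v \<noteq> v"
    and "I = card {e \<in> E. symmetric_edge t e}"
  shows "real (card {C. one_cycle V E C \<and> symmetric_edge_set t C}) =
    (if I = 0 then 2 powr ((real (card E) - real (card V) + 2) / 2)
     else 2 powr ((real (card E) - real (card V) + real I) / 2))"
proof -
  interpret free_involution_graph V E t
    using assms by unfold_locales auto
  let ?n = "card {C. one_cycle V E C \<and> symmetric_edge_set t C}"
  \<comment> \<open>Merges the two cases of the formula. By finiteness of \<open>E\<close>,
    \<open>I = 0\<close> means that no edge is symmetric.\<close>
  define k where "k = (if I = 0 then 2 else I)"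
  have "{C. one_cycle V E C \<and> symmetric_edge_set t C} = sym_cycles"
    by (auto simp: sym_cycles_def sym_edge_sets_def one_cycle_iff_boundary symmetric_edge_set_def)
  moreover have "(if {e \<in> E. t ` e = e} = {} then 2 else card {e \<in> E. t ` e = e}) = k"
    using finite_E assms(4) by (auto simp: k_def symmetric_edge_def)
  ultimately have "?n\<^sup>2 * 2 ^ card V = 2 ^ (card E + k)"
    using card_sym_cycles by simp
  then have "real (?n\<^sup>2 * 2 ^ card V) = real (2 ^ (card E + k))" by (rule arg_cong)
  then have "(real ?n)\<^sup>2 * 2 powr real (card V) = 2 powr (real (card E) + real k)"
    by (simp add: powr_realpow powr_add power_add)
  then have "(real ?n)\<^sup>2 = 2 powr (real (card E) - real (card V) + real k)"
    by (simp add: powr_add powr_diff field_simps)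
  also have "\<dots> = (2 powr ((real (card E) - real (card V) + real k) / 2))\<^sup>2"
    by (simp add: power2_eq_square flip: powr_add)
  \<comment> \<open>Both bases are nonnegative, so equal squares give equal numbers.\<close>
  finally have "real ?n = 2 powr ((real (card E) - real (card V) + real k) / 2)"
    by simp
  then show ?thesis by (simp add: k_def)
qed

end
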